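(* Let $p>1$ be an integer and let $u^{(p)}$ be the fixed point of the substitution $\varphi_p(L)=L^pS$, $\varphi_p(S)=M$, $\varphi_p(M)=L^{p-1}S$, with Abelian complexity $\mathrm{AC}$. (i) $\mathrm{AC}(n)\le 7$ for all $n\in\mathbb N$. (ii) The bound $7$ cannot be improved; moreover, there are infinitely many $n\in\mathbb N$ such that $\mathrm{AC}(n)=7$.
   Context: $u^{(p)}=\lim_{n\to\infty}\varphi_p^n(L)$. For a finite word $w$, its Parikh vector is $\Psi(w)=(|w|_L,|w|_S,|w|_M)$, where $|w|_a$ is the number of occurrences of $a$ in $w$. The Abelian complexity of $u^{(p)}$ is $\mathrm{AC}(n)=\#\{\Psi(w): w \text{ a factor of } u^{(p)} \text{ of length } n\}$. *)

theory Defs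
  imports Main
begin

datatype letter = L | S | M

fun phi :: "nat \<Rightarrow> letter \<Rightarrow> letter list" where
  "phi p L = replicate p L @ [S]"
| "phi p S = [M]"
| "phi p M = replicate (p - 1) L @ [S]"

definition phi_word :: "nat \<Rightarrow> letter list \<Rightarrow> letter list" where
  "phi_word p w = concat (map (phi p) w)"

text \<open>The fixed point u^(p) = lim phi_p^n(L), as an infinite word nat => letter.
  Since phi_p^k(L) is a prefix of phi_p^(k+1)(L) and |phi_p^k(L)| >= 2^k for p > 1,
  the letter at position n is the n-th letter of phi_p^(n+1)(L).\<close>
definition u :: "nat \<Rightarrow> nat \<Rightarrow> letter" where
  "u p n = ((phi_word p ^^ Suc n) [L]) ! n"

definition factor :: "nat \<Rightarrow> nat \<Rightarrow> nat \<Rightarrow> letter list" where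
  "factor p i n = map (u p) [i..<i + n]"

definition parikh :: "letter list \<Rightarrow> nat \<times> nat \<times> nat" where
  "parikh w = (count_list w L, count_list w S, count_list w M)"

definition AC :: "nat \<Rightarrow> nat \<Rightarrow> nat" where
  "AC p n = card {parikh (factor p i n) | i. True}"

end

theory Submission
  imports Defs
begin

text \<open>
  The Parikh vectors of two factors of equal length differ by an alternating sum of the Parikh
  vectors of four prefixes of the fixed point. More generally, let two prefixes count positively and
  two negatively, and let $(t, s, m)$ be the resulting difference of lengths and of numbers of
  letters S and M. Each prefix is the image of a shorter prefix followed by a block of letters L, so
  $(t, s, m)$ is determined by the triple of the four shorter prefixes up to the lengths of these
  blocks. An explicit finite list of constraints on $(t, s, m)$ for $|t| \<le> 2$ is stable under this
  desubstitution, hence always holds. At $t = 0$ it says that any two pairs $(s, m)$ of factors of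
  the same length differ by at most 2 in each coordinate, and that a difference 2 in $s$ excludes a
  positive difference in $m$; a set of pairs with this property has at most 7 elements.

  Conversely, 7 factors with distinct Parikh vectors are exhibited for one length $n_0$. As the
  fixed point begins with the square of the image of L under every power of the substitution,
  the length $n_0$ may be increased by the length of any sufficiently long such image.
\<close>

section \<open>Prefixes of the fixed point\<close>

abbreviation pre :: "nat \<Rightarrow> nat \<Rightarrow> letter list" where
  "pre p n \<equiv> map (u p) [0..<n]"

text \<open>The position at which the image of the letter at position \<open>q\<close> begins, once
  the word is read as a fixed point.\<close>

definition start :: "nat \<Rightarrow> nat \<Rightarrow> nat" where
  "start p q = length (phi_word p (pre p q))"

definition cS :: "nat \<Rightarrow> nat \<Rightarrow> int" where
  "cS p n = int (count_list (pre p n) S)"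

definition cM :: "nat \<Rightarrow> nat \<Rightarrow> int" where
  "cM p n = int (count_list (pre p n) M)"

definition eS :: "letter \<Rightarrow> int" where "eS x = (if x = S then 1 else 0)"
definition eM :: "letter \<Rightarrow> int" where "eM x = (if x = M then 1 else 0)"

text \<open>Every letter image is a run of letters L followed by one other letter; this is the
  length of the run.\<close>

definition block :: "int \<Rightarrow> letter \<Rightarrow> int" where
  "block p x = (if x = L then p else if x = M then p - 1 else 0)"

lemma letter_eqs: "eS L = 0" "eS S = 1" "eS M = 0" "eM L = 0" "eM S = 0" "eM M = 1"
    "block p L = p" "block p S = 0" "block p M = p - 1"
  by (simp_all add: eS_def eM_def block_def)

section \<open>The iterates of the substitution and their limit\<close>

lemma phi_word_simps [simp]:
  "phi_word p [] = []"
  "phi_word p (x # w) = phi p x @ phi_word p w"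
  "phi_word p (v @ w) = phi_word p v @ phi_word p w"
  by (simp_all add: phi_word_def)

lemma phi_neq_Nil [simp]: "phi p x \<noteq> []"
  by (cases x) auto

lemma phi_word_neq_Nil: "w \<noteq> [] \<Longrightarrow> phi_word p w \<noteq> []"
  by (cases w) auto

text \<open>L is a proper prefix of its image, and a substitution that erases no letter preserves
  proper prefixes.\<close>

lemma iterate_Suc_extends:
  assumes "p > 1"
  shows "\<exists>w. w \<noteq> [] \<and> (phi_word p ^^ Suc k) [L] = (phi_word p ^^ k) [L] @ w"
proof (induction k)
  case 0
  have "phi p L = [L] @ (replicate (p - 1) L @ [S])"
    using assms by (cases p) auto
  then show ?case by auto
next
  case (Suc k)
  then obtain w where "w \<noteq> []" "(phi_word p ^^ Suc k) [L] = (phi_word p ^^ k) [L] @ w"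
    by blast
  then have "(phi_word p ^^ Suc (Suc k)) [L] = (phi_word p ^^ Suc k) [L] @ phi_word p w"
    by simp
  then show ?case
    using \<open>w \<noteq> []\<close> phi_word_neq_Nil by blast
qed

lemma length_iterate:
  assumes "p > 1"
  shows "k < length ((phi_word p ^^ k) [L])"
proof (induction k)
  case (Suc k)
  obtain w where "w \<noteq> []" "(phi_word p ^^ Suc k) [L] = (phi_word p ^^ k) [L] @ w"
    using iterate_Suc_extends[OF assms] by blast
  then show ?case
    using Suc by (cases w) auto
qed simp

lemma iterate_extends:
  assumes "p > 1"
  shows "\<exists>w. (phi_word p ^^ (k + d)) [L] = (phi_word p ^^ k) [L] @ w"
proof (induction d)
  case (Suc d)
  then show ?case
    using iterate_Suc_extends[OF assms, of "k + d"] by auto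
qed simp

text \<open>\<open>u\<close> reads each letter off its own iterate. That iterate and the
  \<open>k\<close>-th one are both prefixes of the iterate number \<open>k + Suc n\<close>, so they
  agree where both are defined.\<close>

lemma u_eq_iterate_nth:
  assumes "p > 1" and "n < length ((phi_word p ^^ k) [L])"
  shows "u p n = (phi_word p ^^ k) [L] ! n"
proof -
  have "n < length ((phi_word p ^^ Suc n) [L])"
    using length_iterate[OF assms(1), of "Suc n"] by linarith
  moreover obtain v w where
    "(phi_word p ^^ (k + Suc n)) [L] = (phi_word p ^^ k) [L] @ v"
    "(phi_word p ^^ (Suc n + k)) [L] = (phi_word p ^^ Suc n) [L] @ w"
    using iterate_extends[OF assms(1)] by meson
  ultimately show ?thesis
    using assms(2) unfolding u_def by (metis add.commute nth_append_left)
qed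

lemma pre_eq_take_iterate:
  assumes "p > 1" and "n \<le> length ((phi_word p ^^ k) [L])"
  shows "pre p n = take n ((phi_word p ^^ k) [L])"
  using assms by (intro nth_equalityI) (auto simp: u_eq_iterate_nth)

text \<open>Invariance of the limit under the substitution, on the level of prefixes: the image of a
  prefix of one iterate is a prefix of the next iterate.\<close>

lemma pre_start:
  assumes "p > 1"
  shows "pre p (start p q) = phi_word p (pre p q)"
proof -
  have "q \<le> length ((phi_word p ^^ q) [L])"
    using length_iterate[OF assms, of q] by linarith
  then have "pre p q = take q ((phi_word p ^^ q) [L])"
    by (rule pre_eq_take_iterate[OF assms])
  then have "(phi_word p ^^ Suc q) [L]
      = phi_word p (pre p q) @ phi_word p (drop q ((phi_word p ^^ q) [L]))"
    by (metis append_take_drop_id comp_apply funpow.simps(2) phi_word_simps(3))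
  then show ?thesis
    using pre_eq_take_iterate[OF assms, of "start p q" "Suc q"] by (simp add: start_def)
qed

section \<open>Positions inside letter images\<close>

lemma pre_Suc: "pre p (Suc q) = pre p q @ [u p q]"
  by simp

lemma start_0 [simp]: "start p 0 = 0"
  by (simp add: start_def)

lemma start_Suc: "start p (Suc q) = start p q + length (phi p (u p q))"
  by (simp add: start_def)

lemma pre_start_add:
  assumes "p > 1" and "r \<le> length (phi p (u p q))"
  shows "pre p (start p q + r) = phi_word p (pre p q) @ take r (phi p (u p q))"
proof -
  have "pre p (start p q + r) = take (start p q + r) (pre p (start p (Suc q)))"
    using assms(2) by (simp add: take_map start_Suc)
  then show ?thesis
    unfolding pre_start[OF assms(1)] by (simp add: start_def)
qed

lemma u_start_add:
  assumes "p > 1" and "r < length (phi p (u p q))"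
  shows "u p (start p q + r) = phi p (u p q) ! r"
proof -
  have "u p (start p q + r) = pre p (start p q + Suc r) ! (start p q + r)"
    by (metis add_Suc_right length_map length_upt diff_zero nth_append_length pre_Suc)
  also have "\<dots> = phi p (u p q) ! r"
    using pre_start_add[OF assms(1), of "Suc r" q] assms(2) by (simp add: nth_append start_def)
  finally show ?thesis .
qed

text \<open>The images of the successive letters tile the word, so every position falls into one of
  them, at offset \<open>r\<close>.\<close>

lemma desubstitute:
  obtains q r where "n = start p q + r" "r < length (phi p (u p q))"
proof -
  have "\<exists>q r. n = start p q + r \<and> r < length (phi p (u p q))"
  proof (induction n)
    case 0
    show ?case by (intro exI[of _ 0]) simp
  next
    case (Suc n)
    then obtain q r where qr: "n = start p q + r" "r < length (phi p (u p q))" by blast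
    show ?case
    proof (cases "Suc r < length (phi p (u p q))")
      case True
      then show ?thesis using qr by (metis add_Suc_right)
    next
      case False
      then have "Suc n = start p (Suc q) + 0"
        using qr by (simp add: start_Suc)
      then show ?thesis by (metis length_greater_0_conv phi_neq_Nil)
    qed
  qed
  then show ?thesis using that by blast
qed

section \<open>Letter counts of prefixes\<close>

lemma count_replicate_L: "count_list (replicate n L) S = 0" "count_list (replicate n L) M = 0"
  by (induction n) auto

text \<open>The images of L and M contain one S each and no M, and the image of S is M.\<close>

lemma count_list_phi_word:
  "int (count_list (phi_word p w) S) = int (length w) - int (count_list w S)"
  "count_list (phi_word p w) M = count_list w S"
proof -
  have "int (count_list (phi_word p w) S) = int (length w) - int (count_list w S)
      \<and> count_list (phi_word p w) M = count_list w S"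
  proof (induction w)
    case (Cons x w)
    then show ?case by (cases x) (auto simp: count_replicate_L)
  qed simp
  then show "int (count_list (phi_word p w) S) = int (length w) - int (count_list w S)"
    "count_list (phi_word p w) M = count_list w S" by simp_all
qed

lemma count_take_phi:
  "r < length (phi p x) \<Longrightarrow> count_list (take r (phi p x)) S = 0"
  "r < length (phi p x) \<Longrightarrow> count_list (take r (phi p x)) M = 0"
  by (cases x; auto simp: count_replicate_L)+

text \<open>A proper prefix of a letter image consists of letters L only, so an unfinished image
  adds nothing to the counts.\<close>

lemma cS_start_add:
  assumes "p > 1" and "r < length (phi p (u p q))"
  shows "cS p (start p q + r) = int q - cS p q"
  using assms count_take_phi[OF assms(2)]
  by (simp add: cS_def pre_start_add count_list_phi_word)

lemma cM_start_add:
  assumes "p > 1" and "r < length (phi p (u p q))"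
  shows "cM p (start p q + r) = cS p q"
  using assms count_take_phi[OF assms(2)]
  by (simp add: cS_def cM_def pre_start_add count_list_phi_word)

lemma cS_Suc: "cS p (Suc q) = cS p q + eS (u p q)"
  by (simp add: cS_def eS_def)

lemma cM_Suc: "cM p (Suc q) = cM p q + eM (u p q)"
  by (simp add: cM_def eM_def)

lemma c_0 [simp]: "cS p 0 = 0" "cM p 0 = 0"
  by (simp_all add: cS_def cM_def)

text \<open>The images of L, S and M have lengths p + 1, 1 and p: every letter contributes 1, a
  letter other than S contributes p more, and M loses 1.\<close>

lemma start_eq:
  assumes "p > 1"
  shows "int (start p q) = int q + int p * (int q - cS p q) - cM p q"
proof (induction q)
  case (Suc q)
  then show ?case
    using assms by (cases "u p q") (simp_all add: start_Suc cS_Suc cM_Suc letter_eqs algebra_simps)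
qed simp

lemma u_0 [simp]: "p > 1 \<Longrightarrow> u p 0 = L"
  using u_eq_iterate_nth[of p 0 0] by simp

text \<open>The surplus 2 is what lets \<open>desubstitute_bounded\<close> pass from
  \<open>n \<le> Suc N\<close> to \<open>Suc q \<le> N\<close>.\<close>

lemma start_ge:
  assumes "p > 1" and "q > 0"
  shows "q + 2 \<le> start p q"
  using assms(2)
proof (induction q)
  case (Suc q)
  show ?case
  proof (cases "q = 0")
    case True
    then show ?thesis using assms(1) by (simp add: start_Suc)
  next
    case False
    moreover have "length (phi p (u p q)) > 0" by simp
    ultimately show ?thesis
      using Suc.IH by (simp add: start_Suc del: length_greater_0_conv)
  qed
qed simp

section \<open>Constraints stable under desubstitution\<close>

text \<open>
  Found by computing the triples that occur and enlarging their set until it is stable;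
  for $p = 2$ a few more triples occur than for $p \<ge> 3$.
\<close>
definition upper_bounds :: "int \<Rightarrow> int \<Rightarrow> int \<Rightarrow> int \<Rightarrow> bool" where
  "upper_bounds p t s m \<longleftrightarrow> s + m \<le> 3 \<and> (s = 2 \<longrightarrow> -1 \<le> t \<and> m \<le> t) \<and>
     (if p \<ge> 3 then s \<le> 2 \<and> (m \<le> 2 \<or> t = 2 \<and> s = 0)
      else (s \<le> 2 \<or> s = 3 \<and> t = 2 \<and> m \<le> -1) \<and> (m \<le> 2 \<or> t = 1 \<and> s = -1 \<or> t = 2) \<and>
           (s = 1 \<and> t < 0 \<longrightarrow> m \<le> 1))"

definition admissible :: "int \<Rightarrow> int \<Rightarrow> int \<Rightarrow> int \<Rightarrow> bool" where
  "admissible p t s m \<longleftrightarrow> (\<bar>t\<bar> \<le> 2 \<longrightarrow> upper_bounds p t s m \<and> upper_bounds p (- t) (- s) (- m))"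

text \<open>
  Here $(T, s, m)$ is the triple of the desubstituted prefixes and a, b are the letters that
  follow the two negative ones. The new triple is $(t, T - s, s)$, and only the lower bound on t,
  that is the longest blocks of the negative prefixes, matters. Assumption Q excludes the one
  configuration that the constraints on neighbouring triples leave open.
\<close>
lemma upper_bounds_step:
  fixes p :: int
  assumes p: "p \<ge> 2" and T: "-2 \<le> T" "T \<le> 4"
    and R0: "admissible p T s m"
    and Ra: "admissible p (T - 1) (s - eS a) (m - eM a)"
    and Rb: "admissible p (T - 1) (s - eS b) (m - eM b)"
    and Rab: "admissible p (T - 2) (s - eS a - eS b) (m - eM a - eM b)"
    and Q: "\<not> (s = -2 \<and> m = 2 \<and> a = L \<and> b = L)"
    and t: "t \<le> 2" "-2 \<le> t"
    and lo: "T + p * (T - s) - m - block p a - block p b \<le> t"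
  shows "upper_bounds p t (T - s) s"
proof -
  \<comment> \<open>The product is hidden behind an atom and replaced by its bounds, so that each of
    the nine letter cases is linear arithmetic.\<close>
  define x where "x = p * (T - s)"
  have x: "T - s \<ge> 6 \<Longrightarrow> x \<ge> 6 * p" "T - s \<ge> 5 \<Longrightarrow> x \<ge> 5 * p"
    "T - s \<ge> 4 \<Longrightarrow> x \<ge> 4 * p" "T - s \<ge> 3 \<Longrightarrow> x \<ge> 3 * p" "T - s \<ge> 2 \<Longrightarrow> x \<ge> 2 * p"
    "T - s \<ge> 1 \<Longrightarrow> x \<ge> p" "T - s \<ge> 0 \<Longrightarrow> x \<ge> 0" "T - s \<ge> -1 \<Longrightarrow> x \<ge> - p"
    using p mult_left_mono[of 6 "T - s" p] mult_left_mono[of 5 "T - s" p]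
      mult_left_mono[of 4 "T - s" p] mult_left_mono[of 3 "T - s" p] mult_left_mono[of 2 "T - s" p]
      mult_left_mono[of 1 "T - s" p] mult_left_mono[of 0 "T - s" p]
      mult_left_mono[of "-1" "T - s" p] by (simp_all add: x_def)
  note facts = R0 Ra Rb Rab lo[folded x_def]
  have cLL: ?thesis if "a = L" "b = L"
    using p T t x Q[unfolded that] facts[unfolded that letter_eqs admissible_def upper_bounds_def]
    unfolding upper_bounds_def by (smt (verit))
  have cLS: ?thesis if "a = L" "b = S"
    using p T t x facts[unfolded that letter_eqs admissible_def upper_bounds_def]
    unfolding upper_bounds_def by (smt (verit))
  have cLM: ?thesis if "a = L" "b = M"
    using p T t x facts[unfolded that letter_eqs admissible_def upper_bounds_def]
    unfolding upper_bounds_def by (smt (verit))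
  have cSL: ?thesis if "a = S" "b = L"
    using p T t x facts[unfolded that letter_eqs admissible_def upper_bounds_def]
    unfolding upper_bounds_def by (smt (verit))
  have cSS: ?thesis if "a = S" "b = S"
    using p T t x facts[unfolded that letter_eqs admissible_def upper_bounds_def]
    unfolding upper_bounds_def by (smt (verit))
  have cSM: ?thesis if "a = S" "b = M"
    using p T t x facts[unfolded that letter_eqs admissible_def upper_bounds_def]
    unfolding upper_bounds_def by (smt (verit))
  have cML: ?thesis if "a = M" "b = L"
    using p T t x facts[unfolded that letter_eqs admissible_def upper_bounds_def]
    unfolding upper_bounds_def by (smt (verit))
  have cMS: ?thesis if "a = M" "b = S"
    using p T t x facts[unfolded that letter_eqs admissible_def upper_bounds_def]
    unfolding upper_bounds_def by (smt (verit))
  have cMM: ?thesis if "a = M" "b = M"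
    using p T t x facts[unfolded that letter_eqs admissible_def upper_bounds_def]
    unfolding upper_bounds_def by (smt (verit))
  show ?thesis
    by (cases a; cases b) (fact cLL cLS cLM cSL cSS cSM cML cMS cMM)+
qed

text \<open>Below -2 the constraints at T are void. Lengthening one or both positive prefixes by a
  letter can bring the length difference back to -2 or -1, and the constraints there give the
  conclusion for every t.\<close>

lemma upper_bounds_step_neg:
  assumes T: "-4 \<le> T" "T \<le> -3"
    and Rc: "admissible p (T + 1) (s + eS a) (m + eM a)"
    and Rcd: "admissible p (T + 2) (s + eS a + eS b) (m + eM a + eM b)"
  shows "upper_bounds p t (T - s) s"
proof -
  have "0 \<le> eS a" "eS a \<le> 1" "0 \<le> eS b" "eS b \<le> 1"
    by (simp_all add: eS_def)
  then show ?thesis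
    using assms unfolding admissible_def upper_bounds_def by (smt (verit))
qed

section \<open>Desubstituting four prefixes\<close>

definition balanced :: "nat \<Rightarrow> nat \<Rightarrow> nat \<Rightarrow> nat \<Rightarrow> nat \<Rightarrow> bool" where
  "balanced p i j k l \<longleftrightarrow> admissible (int p) (int i + int j - int k - int l)
     (cS p i + cS p j - cS p k - cS p l) (cM p i + cM p j - cM p k - cM p l)"

lemma remainder_bounds:
  assumes "p > 1" "r < length (phi p x)"
  shows "0 \<le> int r \<and> int r \<le> block (int p) x"
  using assms by (cases x) (auto simp: block_def)

text \<open>The bound is on \<open>Suc q\<close> because the induction hypothesis is also applied to
  prefixes lengthened by one letter.\<close>

lemma desubstitute_bounded:
  assumes "p > 1" "n \<le> Suc N" "1 \<le> N"
  obtains q r where "n = start p q + r" "r < length (phi p (u p q))" "Suc q \<le> N"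
proof -
  obtain q r where qr: "n = start p q + r" "r < length (phi p (u p q))"
    by (rule desubstitute)
  have "Suc q \<le> N"
    using assms qr start_ge[of p q] by (cases "q = 0") auto
  then show ?thesis using qr that by blast
qed

text \<open>Desubstituting once more gives length difference 0 and difference 2 in S. As L does not
  occur in the image of S, neither of the letters at \<open>qk\<close> and \<open>ql\<close> is S.
  Appending them to the negative prefixes keeps the difference 2 but lowers the length difference to
  -2, where the constraints demand at least -1.\<close>

lemma not_both_L:
  assumes p: "p > 1"
    and inv: "\<And>i j k l. i \<le> N \<Longrightarrow> j \<le> N \<Longrightarrow> k \<le> N \<Longrightarrow> l \<le> N \<Longrightarrow> balanced p i j k l"
    and "i \<le> Suc N" "j \<le> Suc N" "k \<le> Suc N" "l \<le> Suc N" "1 \<le> N"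
    and s: "cS p i + cS p j - cS p k - cS p l = -2"
    and m: "cM p i + cM p j - cM p k - cM p l = 2"
  shows "\<not> (u p k = L \<and> u p l = L)"
proof
  assume L: "u p k = L \<and> u p l = L"
  obtain qi ri where i: "i = start p qi + ri" "ri < length (phi p (u p qi))" "Suc qi \<le> N"
    using desubstitute_bounded assms by metis
  obtain qj rj where j: "j = start p qj + rj" "rj < length (phi p (u p qj))" "Suc qj \<le> N"
    using desubstitute_bounded assms by metis
  obtain qk rk where k: "k = start p qk + rk" "rk < length (phi p (u p qk))" "Suc qk \<le> N"
    using desubstitute_bounded assms by metis
  obtain ql rl where l: "l = start p ql + rl" "rl < length (phi p (u p ql))" "Suc ql \<le> N"
    using desubstitute_bounded assms by metis
  have "u p qk \<noteq> S" "u p ql \<noteq> S"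
    using L k l u_start_add[OF p] by fastforce+
  then have e: "eS (u p qk) = 0" "eS (u p ql) = 0"
    by (simp_all add: eS_def)
  have "cS p qi + cS p qj - cS p qk - cS p ql = 2"
    using m by (simp add: i j k l cM_start_add[OF p])
  moreover from this have "int qi + int qj - int qk - int ql = 0"
    using s by (simp add: i j k l cS_start_add[OF p])
  moreover have "balanced p qi qj (Suc qk) (Suc ql)"
    using inv i j k l by simp
  ultimately show False
    unfolding balanced_def admissible_def upper_bounds_def cS_Suc e by simp
qed

text \<open>With T the length difference after desubstitution, s + m = T. Hence \<open>sm\<close>
  confines T to at most 4 in absolute value, and prefixes lengthened by one letter reach the range
  where the constraints say something.\<close>

lemma upper_bounds_desubstitute:
  assumes p: "p > 1"
    and inv: "\<And>i j k l. i \<le> N \<Longrightarrow> j \<le> N \<Longrightarrow> k \<le> N \<Longrightarrow> l \<le> N \<Longrightarrow> balanced p i j k l"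
    and "i \<le> Suc N" "j \<le> Suc N" "k \<le> Suc N" "l \<le> Suc N" "1 \<le> N"
    and t: "t = int i + int j - int k - int l" "\<bar>t\<bar> \<le> 2"
    and s: "s = cS p i + cS p j - cS p k - cS p l"
    and m: "m = cM p i + cM p j - cM p k - cM p l"
    and sm: "\<bar>s + m\<bar> \<le> 4"
  shows "upper_bounds (int p) t s m"
proof -
  obtain qi ri where i: "i = start p qi + ri" "ri < length (phi p (u p qi))" "Suc qi \<le> N"
    using desubstitute_bounded assms by metis
  obtain qj rj where j: "j = start p qj + rj" "rj < length (phi p (u p qj))" "Suc qj \<le> N"
    using desubstitute_bounded assms by metis
  obtain qk rk where k: "k = start p qk + rk" "rk < length (phi p (u p qk))" "Suc qk \<le> N"
    using desubstitute_bounded assms by metis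
  obtain ql rl where l: "l = start p ql + rl" "rl < length (phi p (u p ql))" "Suc ql \<le> N"
    using desubstitute_bounded assms by metis
  define T where "T = int qi + int qj - int qk - int ql"
  define s' where "s' = cS p qi + cS p qj - cS p qk - cS p ql"
  define m' where "m' = cM p qi + cM p qj - cM p qk - cM p ql"
  have ms: "m = s'"
    by (simp add: m s'_def i j k l cM_start_add[OF p])
  have sT: "s = T - s'"
    by (simp add: s T_def s'_def i j k l cS_start_add[OF p])
  have T4: "\<bar>T\<bar> \<le> 4" using sm ms sT by simp
  show ?thesis
  proof (cases "-2 \<le> T")
    case True
    have "admissible (int p) T s' m'"
      using inv[of qi qj qk ql] i j k l by (simp add: balanced_def T_def s'_def m'_def)
    moreover have "admissible (int p) (T - 1) (s' - eS (u p qk)) (m' - eM (u p qk))"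
      using inv[of qi qj "Suc qk" ql] i j k l
      by (simp add: balanced_def T_def s'_def m'_def cS_Suc cM_Suc algebra_simps)
    moreover have "admissible (int p) (T - 1) (s' - eS (u p ql)) (m' - eM (u p ql))"
      using inv[of qi qj qk "Suc ql"] i j k l
      by (simp add: balanced_def T_def s'_def m'_def cS_Suc cM_Suc algebra_simps)
    moreover have "admissible (int p) (T - 2) (s' - eS (u p qk) - eS (u p ql)) (m' - eM (u p qk) - eM (u p ql))"
      using inv[of qi qj "Suc qk" "Suc ql"] i j k l
      by (simp add: balanced_def T_def s'_def m'_def cS_Suc cM_Suc algebra_simps)
    moreover have "\<not> (s' = -2 \<and> m' = 2 \<and> u p qk = L \<and> u p ql = L)"
      using not_both_L[OF p inv, of N qi qj qk ql] i j k l \<open>1 \<le> N\<close>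
      unfolding s'_def m'_def by auto
    moreover have "T + int p * (T - s') - m' - block (int p) (u p qk) - block (int p) (u p ql) \<le> t"
    proof -
      \<comment> \<open>For the lower bound on \<open>t\<close>, offsets in the positive prefixes
        are at least 0 and those in the negative ones at most a full block.\<close>
      have "t = T + int p * (T - s') - m' + int ri + int rj - int rk - int rl"
        by (simp add: t i j k l start_eq[OF p] T_def s'_def m'_def algebra_simps)
      then show ?thesis
        using remainder_bounds[OF p k(2)] remainder_bounds[OF p l(2)] by linarith
    qed
    ultimately show ?thesis
      unfolding ms sT using upper_bounds_step[of "int p" T s' m'] True T4 t(2) p by auto
  next
    case False
    have "admissible (int p) (T + 1) (s' + eS (u p qi)) (m' + eM (u p qi))"
      using inv[of "Suc qi" qj qk ql] i j k l
      by (simp add: balanced_def T_def s'_def m'_def cS_Suc cM_Suc algebra_simps)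
    moreover have "admissible (int p) (T + 2) (s' + eS (u p qi) + eS (u p qj)) (m' + eM (u p qi) + eM (u p qj))"
      using inv[of "Suc qi" "Suc qj" qk ql] i j k l
      by (simp add: balanced_def T_def s'_def m'_def cS_Suc cM_Suc algebra_simps)
    ultimately show ?thesis
      unfolding ms sT using upper_bounds_step_neg[of T "int p" s' _ m'] False T4 by auto
  qed
qed

lemma admissible_sum_bound: "admissible p t s m \<Longrightarrow> \<bar>t\<bar> \<le> 2 \<Longrightarrow> \<bar>s + m\<bar> \<le> 3"
  unfolding admissible_def upper_bounds_def by linarith

text \<open>The outer induction, on a bound for the four lengths, serves the desubstitution. The
  inner one, on their sum, yields the bound 4 on |s + m| that controls the length difference after
  desubstitution.\<close>

lemma balanced_all:
  assumes p: "p > 1"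
  shows "i \<le> N \<Longrightarrow> j \<le> N \<Longrightarrow> k \<le> N \<Longrightarrow> l \<le> N \<Longrightarrow> balanced p i j k l"
proof (induction N arbitrary: i j k l)
  case 0
  then show ?case by (simp add: balanced_def admissible_def upper_bounds_def)
next
  case (Suc N)
  note inv = Suc.IH
  show ?case
  proof (cases "N = 0")
    case True
    \<comment> \<open>A prefix of length at most 1 is empty or L; desubstitution takes over from
      \<open>N \<ge> 1\<close>.\<close>
    have z: "cS p n = 0 \<and> cM p n = 0" if "n \<le> 1" for n
      using that p by (cases n) (simp_all add: cS_Suc cM_Suc letter_eqs)
    show ?thesis
      using Suc.prems True by (simp add: balanced_def admissible_def upper_bounds_def z)
  next
    case False
    show ?thesis
      using Suc.prems
    proof (induction "i + j + k + l" arbitrary: i j k l rule: less_induct)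
      case less
      define t where "t = int i + int j - int k - int l"
      define s where "s = cS p i + cS p j - cS p k - cS p l"
      define m where "m = cM p i + cM p j - cM p k - cM p l"
      have d: "0 \<le> cS p (Suc n) + cM p (Suc n) - cS p n - cM p n
          \<and> cS p (Suc n) + cM p (Suc n) - cS p n - cM p n \<le> 1" for n
        by (cases "u p n") (simp_all add: cS_Suc cM_Suc letter_eqs)
      \<comment> \<open>Shortening a prefix so that t moves towards 0 changes s + m by at most 1.\<close>
      have sm: "\<bar>s + m\<bar> \<le> 4" if "\<bar>t\<bar> \<le> 2"
      proof -
        have "i = 0 \<and> j = 0 \<and> k = 0 \<and> l = 0 \<or> t > 0 \<and> 0 < i \<or> t > 0 \<and> 0 < j
            \<or> t \<le> 0 \<and> 0 < k \<or> t \<le> 0 \<and> 0 < l"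
          unfolding t_def by linarith
        then consider (z) "i = 0" "j = 0" "k = 0" "l = 0" | (i) i' where "t > 0" "i = Suc i'"
          | (j) j' where "t > 0" "j = Suc j'" | (k) k' where "t \<le> 0" "k = Suc k'"
          | (l) l' where "t \<le> 0" "l = Suc l'"
          unfolding gr0_conv_Suc by blast
        then show ?thesis
        proof cases
          case z
          then show ?thesis by (simp add: s_def m_def)
        next
          case i
          have "balanced p i' j k l" using less i by simp
          from admissible_sum_bound[OF this[unfolded balanced_def]] that i show ?thesis
            using d[of i'] by (simp add: t_def s_def m_def) linarith
        next
          case j
          have "balanced p i j' k l" using less j by simp
          from admissible_sum_bound[OF this[unfolded balanced_def]] that j show ?thesis
            using d[of j'] by (simp add: t_def s_def m_def) linarith
        next
          case k
          have "balanced p i j k' l" using less k by simp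
          from admissible_sum_bound[OF this[unfolded balanced_def]] that k show ?thesis
            using d[of k'] by (simp add: t_def s_def m_def) linarith
        next
          case l
          have "balanced p i j k l'" using less l by simp
          from admissible_sum_bound[OF this[unfolded balanced_def]] that l show ?thesis
            using d[of l'] by (simp add: t_def s_def m_def) linarith
        qed
      qed
      have "upper_bounds (int p) t s m" if "\<bar>t\<bar> \<le> 2"
        using upper_bounds_desubstitute[OF p inv, of N i j k l t s m] less.prems False that sm[OF that]
        by (simp add: t_def s_def m_def)
      \<comment> \<open>Exchanging the positive and the negative prefixes negates the
        triple.\<close>
      moreover have "upper_bounds (int p) (- t) (- s) (- m)" if "\<bar>t\<bar> \<le> 2"
        using upper_bounds_desubstitute[OF p inv, of N k l i j "- t" "- s" "- m"] less.prems False that sm[OF that]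
        by (simp add: t_def s_def m_def)
      ultimately show ?case
        unfolding balanced_def admissible_def t_def s_def m_def by blast
    qed
  qed
qed

section \<open>The upper bound\<close>

definition window :: "nat \<Rightarrow> nat \<Rightarrow> nat \<Rightarrow> int \<times> int" where
  "window p n i = (cS p (i + n) - cS p i, cM p (i + n) - cM p i)"

lemma pre_append_factor: "pre p (i + n) = pre p i @ factor p i n"
  unfolding factor_def by (simp only: upt_add_eq_append[of 0 i n, simplified] map_append)

lemma window_eq:
  "window p n i = (int (count_list (factor p i n) S), int (count_list (factor p i n) M))"
  unfolding window_def cS_def cM_def pre_append_factor by simp

lemma count_letters: "count_list w L + count_list w S + count_list w M = length w"
proof (induction w)
  case (Cons x w)
  then show ?case by (cases x) auto
qed simp

text \<open>The length determines the number of letters L, so dropping that coordinate is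
  injective.\<close>

lemma AC_eq_card_window: "AC p n = card (range (window p n))"
proof -
  define g :: "nat \<times> nat \<times> nat \<Rightarrow> int \<times> int" where "g = (\<lambda>(a, b, c). (int b, int c))"
  have "range (window p n) = g ` {parikh (factor p i n) | i. True}"
    unfolding simp_thms full_SetCompr_eq image_image by (simp add: g_def parikh_def window_eq)
  moreover have "inj_on g {parikh (factor p i n) | i. True}"
  proof (rule inj_onI)
    fix v w assume "v \<in> {parikh (factor p i n) | i. True}" "w \<in> {parikh (factor p i n) | i. True}"
    then obtain i j where "v = parikh (factor p i n)" "w = parikh (factor p j n)" by blast
    moreover assume "g v = g w"
    moreover have "length (factor p i n) = length (factor p j n)" by (simp add: factor_def)
    ultimately show "v = w"
      using count_letters[of "factor p i n"] count_letters[of "factor p j n"]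
      by (simp add: parikh_def g_def)
  qed
  ultimately show ?thesis
    unfolding AC_def by (simp add: card_image)
qed

text \<open>Let a and b be the least first and second coordinates, and c the least second coordinate
  in column a. Column a lies in c..b + 2, column a + 1 in b..b + 2, and column a + 2 in b..c by
  comparison with (a, c). The sizes (b - c + 3) + 3 + (c - b + 1) add up to 7.\<close>

lemma card_clique_le_7:
  fixes A :: "(int \<times> int) set"
  assumes D: "\<And>s m s' m'. (s, m) \<in> A \<Longrightarrow> (s', m') \<in> A \<Longrightarrow>
    s - s' \<le> 2 \<and> m - m' \<le> 2 \<and> (s - s' = 2 \<longrightarrow> m \<le> m')"
  shows "card A \<le> 7 \<and> finite A"
proof (cases "A = {}")
  case False
  then obtain s0 m0 where "(s0, m0) \<in> A" by auto
  have "A \<subseteq> {s0 - 2..s0 + 2} \<times> {m0 - 2..m0 + 2}"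
    using D[OF _ \<open>(s0, m0) \<in> A\<close>] D[OF \<open>(s0, m0) \<in> A\<close>] by (force simp: algebra_simps)
  then have fin: "finite A" by (rule finite_subset) simp
  define a where "a = Min (fst ` A)"
  define b where "b = Min (snd ` A)"
  define c where "c = Min {m. (a, m) \<in> A}"
  have "a \<in> fst ` A" "b \<in> snd ` A"
    unfolding a_def b_def using False fin by (auto intro!: Min_in simp del: Min_in)
  then obtain ma sb where ab: "(a, ma) \<in> A" "(sb, b) \<in> A" by auto
  have fc: "finite {m. (a, m) \<in> A}"
    by (rule finite_subset[of _ "snd ` A"]) (use fin in \<open>force+\<close>)
  then have c: "(a, c) \<in> A" and cmin: "\<And>m. (a, m) \<in> A \<Longrightarrow> c \<le> m"
    unfolding c_def using ab(1) Min_in[of "{m. (a, m) \<in> A}"] by auto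
  have lo: "a \<le> s \<and> b \<le> m" if "(s, m) \<in> A" for s m
    unfolding a_def b_def using that fin by (force intro: Min_le)
  have "x \<in> {a} \<times> {c..b + 2} \<union> {a + 1} \<times> {b..b + 2} \<union> {a + 2} \<times> {b..c}" if "x \<in> A" for x
  proof -
    obtain s m where x: "x = (s, m)" by (cases x)
    have "s - a \<le> 2 \<and> m - b \<le> 2 \<and> (s - a = 2 \<longrightarrow> m \<le> c) \<and> (s = a \<longrightarrow> c \<le> m)"
      using D[of s m sb b] D[of s m a c] that ab c cmin[of m] x by auto
    then show ?thesis
      using lo[of s m] that x by auto
  qed
  then have sub: "A \<subseteq> {a} \<times> {c..b + 2} \<union> {a + 1} \<times> {b..b + 2} \<union> {a + 2} \<times> {b..c}"
    by blast
  have "b \<le> c" "c \<le> b + 2"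
    using lo[OF c] D[OF c ab(2)] by auto
  have "card A \<le> card ({a} \<times> {c..b + 2} \<union> {a + 1} \<times> {b..b + 2} \<union> {a + 2} \<times> {b..c})"
    by (rule card_mono[OF _ sub]) simp
  also have "\<dots> \<le> card ({a} \<times> {c..b + 2}) + card ({a + 1} \<times> {b..b + 2}) + card ({a + 2} \<times> {b..c})"
    by (meson add_le_mono1 card_Un_le order_trans)
  also have "\<dots> = 7"
    using \<open>b \<le> c\<close> \<open>c \<le> b + 2\<close> by (simp add: card_cartesian_product)
  finally show ?thesis using fin by simp
qed simp

lemma card_window_le_7:
  assumes "p > 1"
  shows "card (range (window p n)) \<le> 7 \<and> finite (range (window p n))"
proof (rule card_clique_le_7)
  fix s m s' m'
  assume "(s, m) \<in> range (window p n)" "(s', m') \<in> range (window p n)"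
  then obtain i k where "(s, m) = window p n i" "(s', m') = window p n k" by blast
  \<comment> \<open>For these four prefixes the length difference is 0 and the other two differences
    are \<open>s - s'\<close> and \<open>m - m'\<close>.\<close>
  moreover have "balanced p (i + n) k i (k + n)"
    by (rule balanced_all[OF assms, of _ "i + k + n"]) auto
  ultimately show "s - s' \<le> 2 \<and> m - m' \<le> 2 \<and> (s - s' = 2 \<longrightarrow> m \<le> m')"
    unfolding balanced_def admissible_def upper_bounds_def window_def by (auto split: if_splits)
qed

section \<open>Seven Parikh vectors\<close>

text \<open>
  The position X carries the letter a, and y letters S and z letters M precede it. Integers instead
  of naturals allow positions to be written as polynomials in P.
\<close>
definition located :: "int \<Rightarrow> int \<Rightarrow> letter \<Rightarrow> int \<Rightarrow> int \<Rightarrow> bool" where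
  "located P X a y z \<longleftrightarrow> (\<exists>x. int x = X \<and> u (nat P) x = a \<and> cS (nat P) x = y \<and> cM (nat P) x = z)"

lemma located_0: "P \<ge> 2 \<Longrightarrow> located P 0 L 0 0"
  unfolding located_def by (intro exI[of _ 0]) simp

lemma located_step:
  assumes P: "P \<ge> 2" and located: "located P X a y z" and r: "r < length (phi (nat P) a)"
    and b: "phi (nat P) a ! r = b" and "X' = X + P * (X - y) - z + int r" "y' = X - y"
  shows "located P X' b y' y"
proof -
  have p: "nat P > 1" using P by simp
  obtain x where x: "int x = X" "u (nat P) x = a" "cS (nat P) x = y" "cM (nat P) x = z"
    using located unfolding located_def by blast
  show ?thesis
    unfolding located_def
  proof (intro exI[of _ "start (nat P) x + r"] conjI)
    show "int (start (nat P) x + r) = X'"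
      using start_eq[OF p, of x] x assms by simp
    show "u (nat P) (start (nat P) x + r) = b"
      using u_start_add[OF p] x r b by simp
    show "cS (nat P) (start (nat P) x + r) = y'"
      using cS_start_add[OF p] x r assms by simp
    show "cM (nat P) (start (nat P) x + r) = y"
      using cM_start_add[OF p] x r by simp
  qed
qed

lemma located_LL: "P \<ge> 2 \<Longrightarrow> located P X L y z \<Longrightarrow> 0 \<le> r \<Longrightarrow> r < P \<Longrightarrow> X' = X + P * (X - y) - z + r
    \<Longrightarrow> y' = X - y \<Longrightarrow> located P X' L y' y"
  by (rule located_step[where r = "nat r"]) (auto simp: nth_append)

lemma located_LS: "P \<ge> 2 \<Longrightarrow> located P X L y z \<Longrightarrow> X' = X + P * (X - y) - z + P
    \<Longrightarrow> y' = X - y \<Longrightarrow> located P X' S y' y"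
  by (rule located_step[where r = "nat P"]) (auto simp: nth_append)

lemma located_SM: "P \<ge> 2 \<Longrightarrow> located P X S y z \<Longrightarrow> X' = X + P * (X - y) - z
    \<Longrightarrow> y' = X - y \<Longrightarrow> located P X' M y' y"
  by (rule located_step[where r = 0]) auto

lemma located_ML: "P \<ge> 2 \<Longrightarrow> located P X M y z \<Longrightarrow> X' = X + P * (X - y) - z
    \<Longrightarrow> y' = X - y \<Longrightarrow> located P X' L y' y"
  by (rule located_step[where r = 0]) (auto simp: nth_append)

lemma located_MS: "P \<ge> 2 \<Longrightarrow> located P X M y z \<Longrightarrow> X' = X + P * (X - y) - z + (P - 1)
    \<Longrightarrow> y' = X - y \<Longrightarrow> located P X' S y' y"
  by (rule located_step[where r = "nat P - 1"]) (auto simp: nth_append)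

lemma window_between:
  assumes "located P X a y z" "located P X' a' y' z'" "X' = X + N" "N \<ge> 0" "s = y' - y" "m = z' - z"
  shows "(s, m) \<in> range (window (nat P) (nat N))"
proof -
  obtain x x' where x: "int x = X" "cS (nat P) x = y" "cM (nat P) x = z"
      "int x' = X'" "cS (nat P) x' = y'" "cM (nat P) x' = z'"
    using assms(1,2) unfolding located_def by blast
  then have "x' = x + nat N" using assms(3,4) by linarith
  then have "window (nat P) (nat N) x = (s, m)"
    using x assms by (simp add: window_def)
  then show ?thesis by (metis rangeI)
qed

text \<open>The seven offsets form the extremal configuration in \<open>card_clique_le_7\<close>,
  with a = b = -1 and c = 0.\<close>

lemma seven_windows:
  assumes P: "P \<ge> 2"
  shows "\<exists>n s0 m0. (\<lambda>(s, m). (s0 + s, m0 + m)) `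
    {(0, 0), (0, 1), (-1, 1), (1, 0), (0, -1), (1, -1), (-1, 0)} \<subseteq> range (window (nat P) n)"
proof -
  \<comment> \<open>The digits in a fact name, with q for P - 1 and p for P, are the successive block lengths that
    lead to the position when the prefix is built up by repeated substitution.\<close>
  note expand = algebra_simps eval_nat_numeral
  have dq: "located P (P - 1) L 0 0"
    by (rule located_LL[OF P located_0[OF P], where r = "P - 1"]) (use P in \<open>simp_all add: expand\<close>)
  have dq0: "located P (P ^ 2 - 1) L (P - 1) 0"
    by (rule located_LL[OF P dq, where r = "0"]) (use P in \<open>simp_all add: expand\<close>)
  have dq0q: "located P (P ^ 3 + P - 2) L (P ^ 2 - P) (P - 1)"
    by (rule located_LL[OF P dq0, where r = "P - 1"]) (use P in \<open>simp_all add: expand\<close>)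
  have dq0q1: "located P (P ^ 4 + 2 * P ^ 2 - 2 * P) L (P ^ 3 - P ^ 2 + 2 * P - 2) (P ^ 2 - P)"
    by (rule located_LL[OF P dq0q, where r = "1"]) (use P in \<open>simp_all add: expand\<close>)
  have dq0p: "located P (P ^ 3 + P - 1) S (P ^ 2 - P) (P - 1)"
    by (rule located_LS[OF P dq0]) (use P in \<open>simp_all add: expand\<close>)
  have dq0p0: "located P (P ^ 4 + 2 * P ^ 2 - P) M (P ^ 3 - P ^ 2 + 2 * P - 1) (P ^ 2 - P)"
    by (rule located_SM[OF P dq0p]) (use P in \<open>simp_all add: expand\<close>)
  have dq0q0: "located P (P ^ 4 + 2 * P ^ 2 - 2 * P - 1) L (P ^ 3 - P ^ 2 + 2 * P - 2) (P ^ 2 - P)"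
    by (rule located_LL[OF P dq0q, where r = "0"]) (use P in \<open>simp_all add: expand\<close>)
  have dq0q0p: "located P (P ^ 5 + 3 * P ^ 3 - 3 * P ^ 2 + P - 1) S (P ^ 4 - P ^ 3 + 3 * P ^ 2 - 4 * P + 1) (P ^ 3 - P ^ 2 + 2 * P - 2)"
    by (rule located_LS[OF P dq0q0]) (use P in \<open>simp_all add: expand\<close>)
  have dq0p00: "located P (P ^ 5 + 3 * P ^ 3 - 2 * P ^ 2 + P) L (P ^ 4 - P ^ 3 + 3 * P ^ 2 - 3 * P + 1) (P ^ 3 - P ^ 2 + 2 * P - 1)"
    by (rule located_ML[OF P dq0p0]) (use P in \<open>simp_all add: expand\<close>)
  have dq0p0q: "located P (P ^ 5 + 3 * P ^ 3 - 2 * P ^ 2 + 2 * P - 1) S (P ^ 4 - P ^ 3 + 3 * P ^ 2 - 3 * P + 1) (P ^ 3 - P ^ 2 + 2 * P - 1)"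
    by (rule located_MS[OF P dq0p0]) (use P in \<open>simp_all add: expand\<close>)
  have dp: "located P P S 0 0"
    by (rule located_LS[OF P located_0[OF P]]) (use P in \<open>simp_all add: expand\<close>)
  have dp0: "located P (P ^ 2 + P) M P 0"
    by (rule located_SM[OF P dp]) (use P in \<open>simp_all add: expand\<close>)
  have dp0q: "located P (P ^ 3 + P ^ 2 + 2 * P - 1) S (P ^ 2) P"
    by (rule located_MS[OF P dp0]) (use P in \<open>simp_all add: expand\<close>)
  have dp0q0: "located P (P ^ 4 + P ^ 3 + 3 * P ^ 2 - 1) M (P ^ 3 + 2 * P - 1) (P ^ 2)"
    by (rule located_SM[OF P dp0q]) (use P in \<open>simp_all add: expand\<close>)
  have dp0q00: "located P (P ^ 5 + P ^ 4 + 4 * P ^ 3 - 1) L (P ^ 4 + 3 * P ^ 2 - 2 * P) (P ^ 3 + 2 * P - 1)"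
    by (rule located_ML[OF P dp0q0]) (use P in \<open>simp_all add: expand\<close>)
  have dp0q000: "located P (P ^ 6 + P ^ 5 + 5 * P ^ 4 + 2 * P ^ 2 - 3 * P) L (P ^ 5 + 4 * P ^ 3 - 3 * P ^ 2 + 2 * P - 1) (P ^ 4 + 3 * P ^ 2 - 2 * P)"
    by (rule located_LL[OF P dp0q00, where r = "0"]) (use P in \<open>simp_all add: expand\<close>)
  have d1: "located P 1 L 0 0"
    by (rule located_LL[OF P located_0[OF P], where r = "1"]) (use P in \<open>simp_all add: expand\<close>)
  have d11: "located P (P + 2) L 1 0"
    by (rule located_LL[OF P d1, where r = "1"]) (use P in \<open>simp_all add: expand\<close>)
  have d110: "located P (P ^ 2 + 2 * P + 2) L (P + 1) 1"
    by (rule located_LL[OF P d11, where r = "0"]) (use P in \<open>simp_all add: expand\<close>)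
  have d1100: "located P (P ^ 3 + 2 * P ^ 2 + 3 * P + 1) L (P ^ 2 + P + 1) (P + 1)"
    by (rule located_LL[OF P d110, where r = "0"]) (use P in \<open>simp_all add: expand\<close>)
  have d11000: "located P (P ^ 4 + 2 * P ^ 3 + 4 * P ^ 2 + 2 * P) L (P ^ 3 + P ^ 2 + 2 * P) (P ^ 2 + P + 1)"
    by (rule located_LL[OF P d1100, where r = "0"]) (use P in \<open>simp_all add: expand\<close>)
  have d2000: "located P (2 * P ^ 3 + 2 * P ^ 2 + 4 * P) L (2 * P ^ 2 + 2) (2 * P)"
  \<comment> \<open>Position 2 carries L for \<open>P \<ge> 3\<close> but S for
    \<open>P = 2\<close>. In the latter case the letter returns to L by way of M, and the positions
    and counts fit the same polynomials.\<close>
  proof (cases "P = 2")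
    case True
    have "located P 2 S 0 0"
      by (rule located_LS[OF P located_0[OF P]]) (simp_all add: True)
    then have "located P (2 * P + 2) M 2 0"
      by (rule located_SM[OF P]) (simp_all add: True)
    then have "located P (2 * P ^ 2 + 2 * P + 2) L (2 * P) 2"
      by (rule located_ML[OF P]) (simp_all add: True)
    then show ?thesis
      by (rule located_LL[OF P, where r = 0]) (simp_all add: True)
  next
    case False
    have "located P 2 L 0 0"
      by (rule located_LL[OF P located_0[OF P], where r = 2]) (use P False in simp_all)
    then have "located P (2 * P + 2) L 2 0"
      by (rule located_LL[OF P, where r = 0]) (use P in simp_all)
    then have "located P (2 * P ^ 2 + 2 * P + 2) L (2 * P) 2"
      by (rule located_LL[OF P, where r = 0]) (use P in \<open>simp_all add: power2_eq_square algebra_simps\<close>)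
    then show ?thesis
      by (rule located_LL[OF P, where r = 0]) (use P in \<open>simp_all add: expand\<close>)
  qed
  have d20000: "located P (2 * P ^ 4 + 2 * P ^ 3 + 6 * P ^ 2) L (2 * P ^ 3 + 4 * P - 2) (2 * P ^ 2 + 2)"
    by (rule located_LL[OF P d2000, where r = "0"]) (use P in \<open>simp_all add: expand\<close>)
  have d2000p: "located P (2 * P ^ 4 + 2 * P ^ 3 + 6 * P ^ 2 + P) S (2 * P ^ 3 + 4 * P - 2) (2 * P ^ 2 + 2)"
    by (rule located_LS[OF P d2000]) (use P in \<open>simp_all add: expand\<close>)
  have d10: "located P (P + 1) L 1 0"
    by (rule located_LL[OF P d1, where r = "0"]) (use P in \<open>simp_all add: expand\<close>)
  have d101: "located P (P ^ 2 + P + 2) L P 1"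
    by (rule located_LL[OF P d10, where r = "1"]) (use P in \<open>simp_all add: expand\<close>)
  have d1010: "located P (P ^ 3 + P ^ 2 + 3 * P + 1) L (P ^ 2 + 2) P"
    by (rule located_LL[OF P d101, where r = "0"]) (use P in \<open>simp_all add: expand\<close>)
  have d10100: "located P (P ^ 4 + P ^ 3 + 4 * P ^ 2 + P + 1) L (P ^ 3 + 3 * P - 1) (P ^ 2 + 2)"
    by (rule located_LL[OF P d1010, where r = "0"]) (use P in \<open>simp_all add: expand\<close>)
  have d101000: "located P (P ^ 5 + P ^ 4 + 5 * P ^ 3 + P ^ 2 + 3 * P - 1) L (P ^ 4 + 4 * P ^ 2 - 2 * P + 2) (P ^ 3 + 3 * P - 1)"
    by (rule located_LL[OF P d10100, where r = "0"]) (use P in \<open>simp_all add: expand\<close>)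
  have d1010q: "located P (P ^ 4 + P ^ 3 + 4 * P ^ 2 + 2 * P) L (P ^ 3 + 3 * P - 1) (P ^ 2 + 2)"
    by (rule located_LL[OF P d1010, where r = "P - 1"]) (use P in \<open>simp_all add: expand\<close>)
  \<comment> \<open>Offset 2 in the image of L carries S when \<open>P = 2\<close> and L otherwise.
    The position only serves as the end of a factor, so its letter may stay abstract.\<close>
  have "\<exists>b. located P (P ^ 5 + P ^ 4 + 5 * P ^ 3 + 2 * P ^ 2 + 3 * P) b (P ^ 4 + 4 * P ^ 2 - P + 1) (P ^ 3 + 3 * P - 1)"
  proof (cases "P = 2")
    case True
    have "located P (P ^ 5 + P ^ 4 + 5 * P ^ 3 + 2 * P ^ 2 + 3 * P) S (P ^ 4 + 4 * P ^ 2 - P + 1) (P ^ 3 + 3 * P - 1)"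
      by (rule located_LS[OF P d1010q]) (simp_all add: True)
    then show ?thesis ..
  next
    case False
    have "located P (P ^ 5 + P ^ 4 + 5 * P ^ 3 + 2 * P ^ 2 + 3 * P) L (P ^ 4 + 4 * P ^ 2 - P + 1) (P ^ 3 + 3 * P - 1)"
      by (rule located_LL[OF P d1010q, where r = 2]) (use P False in \<open>simp_all add: expand\<close>)
    then show ?thesis ..
  qed
  then obtain b where d1010q2: "located P (P ^ 5 + P ^ 4 + 5 * P ^ 3 + 2 * P ^ 2 + 3 * P) b (P ^ 4 + 4 * P ^ 2 - P + 1) (P ^ 3 + 3 * P - 1)" ..
  have d1010p: "located P (P ^ 4 + P ^ 3 + 4 * P ^ 2 + 2 * P + 1) S (P ^ 3 + 3 * P - 1) (P ^ 2 + 2)"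
    by (rule located_LS[OF P d1010]) (use P in \<open>simp_all add: expand\<close>)
  have d1010p0: "located P (P ^ 5 + P ^ 4 + 5 * P ^ 3 + 2 * P ^ 2 + 4 * P - 1) M (P ^ 4 + 4 * P ^ 2 - P + 2) (P ^ 3 + 3 * P - 1)"
    by (rule located_SM[OF P d1010p]) (use P in \<open>simp_all add: expand\<close>)
  have d1010q1: "located P (P ^ 5 + P ^ 4 + 5 * P ^ 3 + 2 * P ^ 2 + 3 * P - 1) L (P ^ 4 + 4 * P ^ 2 - P + 1) (P ^ 3 + 3 * P - 1)"
    by (rule located_LL[OF P d1010q, where r = "1"]) (use P in \<open>simp_all add: expand\<close>)
  have d1010q1p: "located P (P ^ 6 + P ^ 5 + 6 * P ^ 4 + 2 * P ^ 3 + 6 * P ^ 2 - P) S (P ^ 5 + 5 * P ^ 3 - 2 * P ^ 2 + 4 * P - 2) (P ^ 4 + 4 * P ^ 2 - P + 1)"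
    by (rule located_LS[OF P d1010q1]) (use P in \<open>simp_all add: expand\<close>)
  \<comment> \<open>The common length is the position of \<open>d11000\<close> and the base point
    its counts: the first factor is a prefix, and the other six lie between positions at this
    distance.\<close>
  let ?N = "nat (P ^ 4 + 2 * P ^ 3 + 4 * P ^ 2 + 2 * P)" and ?s0 = "P ^ 3 + P ^ 2 + 2 * P" and ?m0 = "P ^ 2 + P + 1"
  have "(?s0 + 0, ?m0 + 0) \<in> range (window (nat P) ?N)"
    by (rule window_between[OF located_0[OF P] d11000]) (use P in simp_all)
  moreover have "(?s0 + 0, ?m0 + 1) \<in> range (window (nat P) ?N)"
    by (rule window_between[OF dq0q1 d20000]) (use P in simp_all)
  moreover have "(?s0 + -1, ?m0 + 1) \<in> range (window (nat P) ?N)"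
    by (rule window_between[OF dq0p0 d2000p]) (use P in simp_all)
  moreover have "(?s0 + 1, ?m0 + 0) \<in> range (window (nat P) ?N)"
    by (rule window_between[OF dq0q0p d101000]) (use P in simp_all)
  moreover have "(?s0 + 0, ?m0 + -1) \<in> range (window (nat P) ?N)"
    by (rule window_between[OF dq0p00 d1010q2]) (use P in simp_all)
  moreover have "(?s0 + 1, ?m0 + -1) \<in> range (window (nat P) ?N)"
    by (rule window_between[OF dq0p0q d1010p0]) (use P in simp_all)
  moreover have "(?s0 + -1, ?m0 + 0) \<in> range (window (nat P) ?N)"
    by (rule window_between[OF dp0q000 d1010q1p]) (use P in simp_all)
  ultimately show ?thesis
    by (intro exI[of _ ?N] exI[of _ ?s0] exI[of _ ?m0]) simp
qed

section \<open>Square prefixes and infinitely many lengths\<close>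

lemma pre_start_add_start:
  assumes "p > 1" "pre p (q + K) = pre p q @ pre p K"
  shows "pre p (start p q + start p K) = pre p (start p q) @ pre p (start p K)"
proof -
  have "phi_word p (pre p (q + K)) = phi_word p (pre p q) @ phi_word p (pre p K)"
    unfolding assms(2) by simp
  moreover from this have "start p (q + K) = start p q + start p K"
    unfolding start_def by simp
  ultimately show ?thesis
    using pre_start[OF assms(1)] by metis
qed

text \<open>The word begins with LL, and the substitution maps square prefixes to square prefixes;
  \<open>(start p ^^ k) 1\<close> is the length of the \<open>k\<close>-th iterate on L.\<close>

lemma prefix_square:
  assumes "p > 1"
  shows "pre p ((start p ^^ k) 1 + (start p ^^ k) 1) = pre p ((start p ^^ k) 1) @ pre p ((start p ^^ k) 1)"
proof (induction k)
  case 0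
  have "u p 1 = L"
    using u_start_add[OF assms, of 1 0] assms by (simp add: nth_append)
  then show ?case using assms by (simp add: numeral_2_eq_2)
next
  case (Suc k)
  then show ?case using pre_start_add_start[OF assms] by simp
qed

lemma funpow_start_gt:
  assumes "p > 1"
  shows "k < (start p ^^ k) 1"
proof (induction k)
  case (Suc k)
  then show ?case using start_ge[OF assms, of "(start p ^^ k) 1"] by simp
qed simp

lemma count_square:
  assumes "p > 1" "x \<le> (start p ^^ k) 1"
  shows "cS p ((start p ^^ k) 1 + x) = cS p ((start p ^^ k) 1) + cS p x"
    "cM p ((start p ^^ k) 1 + x) = cM p ((start p ^^ k) 1) + cM p x"
proof -
  define q where "q = (start p ^^ k) 1"
  have "pre p (q + x) = take (q + x) (pre p (q + q))"
    using assms(2) by (simp add: take_map q_def)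
  also have "\<dots> = pre p q @ pre p x"
    using assms(2) prefix_square[OF assms(1), of k] by (simp add: take_map q_def)
  finally have "pre p (q + x) = pre p q @ pre p x" .
  then show "cS p ((start p ^^ k) 1 + x) = cS p ((start p ^^ k) 1) + cS p x"
    "cM p ((start p ^^ k) 1 + x) = cM p ((start p ^^ k) 1) + cM p x"
    unfolding cS_def cM_def q_def[symmetric] by simp_all
qed

text \<open>Let q be the length of the \<open>k\<close>-th iterate on L. Lengthening by q letters a
  factor that ends at or before q adds the counts of the prefix of length q. This shift is the same
  for all seven factors, so their pairs stay distinct, and seven is also the upper bound.\<close>

lemma AC_eq_7:
  assumes p: "p > 1"
  shows "\<exists>n B. \<forall>k\<ge>B. AC p ((start p ^^ k) 1 + n) = 7"
proof -
  define V :: "(int \<times> int) set" where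
    "V = {(0, 0), (0, 1), (-1, 1), (1, 0), (0, -1), (1, -1), (-1, 0)}"
  have V: "finite V" "card V = 7"
    by (simp_all add: V_def)
  obtain n s0 m0 where sub: "(\<lambda>(s, m). (s0 + s, m0 + m)) ` V \<subseteq> range (window p n)"
    using seven_windows[of "int p"] p unfolding V_def by auto
  obtain A where A: "finite A" "(\<lambda>(s, m). (s0 + s, m0 + m)) ` V = window p n ` A"
    using finite_subset_image[OF _ sub] V(1) by auto
  \<comment> \<open>Finitely many starting positions realise the seven pairs, so one threshold
    serves them all.\<close>
  obtain B where B: "\<And>i. i \<in> A \<Longrightarrow> i + n \<le> B"
    using finite_nat_set_iff_bounded_le[of "(\<lambda>i. i + n) ` A"] A(1) by auto
  have "AC p ((start p ^^ k) 1 + n) = 7" if "k \<ge> B" for k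
  proof -
    define q where "q = (start p ^^ k) 1"
    have "window p (q + n) i = (case window p n i of (s, m) \<Rightarrow> (cS p q + s, cM p q + m))"
      if "i \<in> A" for i
    proof -
      have "i + n \<le> q"
        using B[OF that] \<open>k \<ge> B\<close> funpow_start_gt[OF p, of k] unfolding q_def by linarith
      then have "cS p (q + (i + n)) = cS p q + cS p (i + n)" "cM p (q + (i + n)) = cM p q + cM p (i + n)"
        using count_square[OF p] unfolding q_def by blast+
      then show ?thesis by (simp add: window_def add.left_commute)
    qed
    then have "window p (q + n) ` A = (\<lambda>(s, m). (cS p q + s, cM p q + m)) ` window p n ` A"
      unfolding image_image by (intro image_cong) auto
    also have "\<dots> = (\<lambda>(s, m). (cS p q + s0 + s, cM p q + m0 + m)) ` V"
      unfolding A(2)[symmetric] image_image by (intro image_cong) (auto simp: algebra_simps)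
    finally have "card (window p (q + n) ` A) = card V"
      by (simp add: card_image inj_on_def case_prod_unfold prod_eq_iff)
    moreover have "card (window p (q + n) ` A) \<le> card (range (window p (q + n)))"
      using card_window_le_7[OF p] by (intro card_mono) auto
    ultimately show ?thesis
      unfolding AC_eq_card_window q_def[symmetric] using V(2) card_window_le_7[OF p, of "q + n"] by simp
  qed
  then show ?thesis by blast
qed

theorem theorem8p3:
  fixes p :: nat
  assumes "p > 1"
  shows "(\<forall>n. AC p n \<le> 7) \<and> infinite {n. AC p n = 7}"
proof
  show "\<forall>n. AC p n \<le> 7"
    unfolding AC_eq_card_window using card_window_le_7[OF assms] by blast
  obtain n B where nB: "\<And>k. k \<ge> B \<Longrightarrow> AC p ((start p ^^ k) 1 + n) = 7"
    using AC_eq_7[OF assms] by blast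
  show "infinite {n. AC p n = 7}"
  proof
    assume "finite {n. AC p n = 7}"
    then obtain m where m: "\<And>n. AC p n = 7 \<Longrightarrow> n \<le> m"
      unfolding finite_nat_set_iff_bounded_le by blast
    have "m < (start p ^^ (max m B)) 1 + n"
      using funpow_start_gt[OF assms, of "max m B"] by linarith
    then show False
      using m[OF nB[of "max m B"]] by simp
  qed
qed

end
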